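(* Let $n\ge 1$ and $\pi\in\mathcal S_n(132,213)$. Starting from the composition $\kappa(\pi)$, repeatedly do the following until the current composition $(a_1,\dots,a_k)$ either has $a_1=a_k$ or consists of a single part: if $a_1<a_k$, reverse the composition to $(a_k,\dots,a_1)$; if $a_1>a_k$, replace the composition by its reduction $r(a_1,\dots,a_k)$. Then $\pi$ is cyclic if the composition at which this procedure stops is $(1,1)$ or $(1)$, and $\pi$ is not cyclic otherwise.
   Context: $\mathcal S_n(132,213)$ is the set of permutations of $[n]=\{1,\dots,n\}$ which, in one-line notation, avoid the patterns $132$ and $213$. A permutation of $[n]$ is cyclic if its cycle decomposition is a single cycle of length $n$. For $\sigma\in\mathcal S_p$ and $\tau\in\mathcal S_q$, the skew sum is $\sigma\ominus\tau=(\sigma_1+q)\cdots(\sigma_p+q)\,\tau_1\cdots\tau_q$, and $\mathrm{id}_a=12\cdots a$. Every $\pi\in\mathcal S_n(132,213)$ is uniquely of the form $\mathrm{id}_{a_1}\ominus\cdots\ominus\mathrm{id}_{a_k}$ with $(a_1,\dots,a_k)$ a composition of $n$ (a tuple of positive integers with sum $n$); write $\kappa(\pi)=(a_1,\dots,a_k)$. For a composition with $k\ge2$ and $a_1>a_k$, the reduction is $$r(a_1,\dots,a_k)=\begin{cases}(a_k,a_2,\dots,a_{k-1},2a_k-a_1), & 2a_k>a_1>a_k,\\ (a_1-2a_k,a_k,a_2,\dots,a_{k-1}), & a_1>2a_k,\\ (a_k,a_2,\dots,a_{k-1}), & a_1=2a_k,\end{cases}$$ where the segment $a_2,\dots,a_{k-1}$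 is empty when $k=2$ and is the single entry $a_2$ when $k=3$. *)

theory Defs
  imports
    "HOL-Combinatorics.Cycles"
    "HOL-Library.Sublist"
    "HOL-Library.While_Combinator"
begin

definition one_line :: "nat \<Rightarrow> (nat \<Rightarrow> nat) \<Rightarrow> nat list" where
  "one_line n p = map p [1..<Suc n]"

definition order_iso :: "nat list \<Rightarrow> nat list \<Rightarrow> bool" where
  "order_iso u s \<longleftrightarrow>
     length u = length s \<and>
     (\<forall>i<length s. \<forall>j<length s. u ! i < u ! j \<longleftrightarrow> s ! i < s ! j)"

definition contains_pattern :: "nat list \<Rightarrow> nat list \<Rightarrow> bool" where
  "contains_pattern w s \<longleftrightarrow> (\<exists>u. subseq u w \<and> order_iso u s)"

definition avoiders :: "nat \<Rightarrow> nat list set \<Rightarrow> (nat \<Rightarrow> nat) set" where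
  "avoiders n S =
     {p. p permutes {1..n} \<and> (\<forall>s\<in>S. \<not> contains_pattern (one_line n p) s)}"

text \<open>The cycle \<open>cs\<close> may have length one, in which case \<^term>\<open>cycle_of_list cs = id\<close>.\<close>
definition is_cyclic :: "nat \<Rightarrow> (nat \<Rightarrow> nat) \<Rightarrow> bool" where
  "is_cyclic n p \<longleftrightarrow>
     (\<exists>cs. cycle cs \<and> set cs = {1..n} \<and> length cs = n \<and> p = cycle_of_list cs)"

definition skew_sum :: "nat list \<Rightarrow> nat list \<Rightarrow> nat list" where
  "skew_sum s t = map (\<lambda>x. x + length t) s @ t"

definition id_list :: "nat \<Rightarrow> nat list" where
  "id_list a = [1..<Suc a]"

definition composition :: "nat \<Rightarrow> nat list \<Rightarrow> bool" where
  "composition n as \<longleftrightarrow> (\<forall>a\<in>set as. 0 < a) \<and> sum_list as = n"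

text \<open>The skew sum is associative with the empty list as unit, so the right fold is the
  iterated skew sum of the identity blocks.\<close>
definition kappa :: "nat \<Rightarrow> (nat \<Rightarrow> nat) \<Rightarrow> nat list" where
  "kappa n p =
     (THE as. composition n as \<and> one_line n p = foldr skew_sum (map id_list as) [])"

text \<open>Only meaningful for lists with at least two entries, all positive, with
  \<^term>\<open>hd as > last as\<close>; then the three branches are exhaustive.\<close>
definition reduction :: "nat list \<Rightarrow> nat list" where
  "reduction as =
     (let a\<^sub>1 = hd as; a\<^sub>k = last as; mid = butlast (tl as) in
        if 2 * a\<^sub>k > a\<^sub>1 \<and> a\<^sub>1 > a\<^sub>k then a\<^sub>k # mid @ [2 * a\<^sub>k - a\<^sub>1]
        else if a\<^sub>1 > 2 * a\<^sub>k then (a\<^sub>1 - 2 * a\<^sub>k) # a\<^sub>k # mid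
        else a\<^sub>k # mid)"

definition stopped :: "nat list \<Rightarrow> bool" where
  "stopped as \<longleftrightarrow> hd as = last as \<or> length as = 1"

definition step :: "nat list \<Rightarrow> nat list" where
  "step as = (if hd as < last as then rev as else reduction as)"

text \<open>The result is \<open>None\<close> exactly if the procedure runs forever.\<close>
definition procedure :: "nat list \<Rightarrow> nat list option" where
  "procedure as = while_option (\<lambda>b. \<not> stopped b) step as"

end

theory Submission
  imports Defs
begin

text \<open>
  A permutation of \<open>{1..n}\<close> is cyclic iff it acts on \<open>{1..n}\<close> with a single orbit, so it suffices
  that each step of the procedure preserves the property of having a single orbit, that the
  procedure terminates, and that the stopping compositions are understood.

  The permutation attached to a composition is a discrete interval exchange: it translates the
  blocks and puts them in the opposite order.  If \<open>R\<close> is a set of points that is disjoint from its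
  image, then the points of \<open>R\<close> can be cut out, every point sent into \<open>R\<close> being forwarded to where
  \<open>R\<close> goes next, and this first-return map has a single orbit iff the original map does
  (\<open>one_orbit_first_return\<close>).  This is Rauzy induction.  Cutting out the last block of
  \<open>(c + b, M, b)\<close> gives an exchange \<open>shear c b M\<close> of the intervals \<open>c, b, M\<close> in which the blocks
  of \<open>M\<close> are still reversed but \<open>b\<close> comes first and \<open>c\<close> last (\<open>one_orbit_cut_last_block\<close>).  The
  three cases of the reduction come out as follows.
  \<^item> If \<open>c < b\<close>, cutting out the first \<open>c\<close> points of \<open>shear c b M\<close> gives
    \<open>shear c (b - c) M\<close> (\<open>one_orbit_shear_diff\<close>), and this is also what the composition
    \<open>(b, M, b - c)\<close> yields when its last block is cut out.  The two permutations are therefore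
    compared through a common first-return map.
  \<^item> If \<open>c \<ge> b\<close>, cutting out the first \<open>b\<close> points of \<open>shear c b M\<close> gives directly the permutation
    of \<open>(c - b, b, M)\<close> (\<open>one_orbit_cut_shear\<close>), and for \<open>c = b\<close> the empty leading block disappears.

  Reversing a composition inverts its permutation.  Every reduction lowers the sum, and a reversal
  is followed by a reduction, so the procedure terminates.  When it stops with at least two parts
  and equal outer parts, the outer blocks are interchanged, so their first points form a
  \<open>2\<close>-cycle, which exhausts everything only for \<open>(1, 1)\<close>; a single part gives an identity.

  That the block exchange is the given permutation rests on the unique decomposition of a
  permutation avoiding 132 and 213 into identity blocks (\<open>avoiding_word_is_skew_sum\<close>,
  \<open>skew_sum_decomposition_unique\<close>).
\<close>

section \<open>Maps with a single orbit\<close>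

definition one_orbit :: "'a set \<Rightarrow> ('a \<Rightarrow> 'a) \<Rightarrow> bool" where
  "one_orbit S f \<longleftrightarrow> (\<forall>x\<in>S. \<forall>y\<in>S. \<exists>k. (f ^^ k) x = y)"

lemma one_orbitD: "one_orbit S f \<Longrightarrow> x \<in> S \<Longrightarrow> y \<in> S \<Longrightarrow> \<exists>k. (f ^^ k) x = y"
  by (auto simp: one_orbit_def)

lemma one_orbit_subset_invariant:
  assumes "one_orbit S f" "x \<in> S" "x \<in> T" "f ` T \<subseteq> T"
  shows "S \<subseteq> T"
proof
  fix y assume "y \<in> S"
  then obtain k where k: "(f ^^ k) x = y" using assms one_orbitD by metis
  have "(f ^^ j) x \<in> T" for j
    using assms by (induction j) auto
  then show "y \<in> T" using k by auto
qed

lemma one_orbit_left_inverse: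
  assumes "one_orbit S f" and "\<And>x. x \<in> S \<Longrightarrow> f x \<in> S" and "\<And>x. x \<in> S \<Longrightarrow> g (f x) = x"
  shows "one_orbit S g"
proof -
  have retrace: "(f ^^ k) x \<in> S \<and> (g ^^ k) ((f ^^ k) x) = x" if "x \<in> S" for k x
    using that
  proof (induction k)
    case (Suc k)
    have "(g ^^ Suc k) ((f ^^ Suc k) x) = (g ^^ k) (g (f ((f ^^ k) x)))"
      by (simp add: funpow_swap1)
    then show ?case using Suc assms by simp
  qed simp
  show ?thesis
    unfolding one_orbit_def
  proof (intro ballI)
    fix x y assume "x \<in> S" "y \<in> S"
    then obtain k where "(f ^^ k) y = x" using one_orbitD[OF assms(1)] by blast
    then show "\<exists>k. (g ^^ k) x = y" using retrace[OF \<open>y \<in> S\<close>, of k] by auto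
  qed
qed

text \<open>
  The removed set \<open>R\<close> is left again after one step, so the first-return map to \<open>S - R\<close> applies
  \<open>f\<close> at most twice.  The map \<open>g\<close> is this first-return map after the relabelling \<open>h\<close>.
\<close>
lemma one_orbit_first_return:
  assumes surj: "f ` S = S" and RS: "R \<subseteq> S" and R: "f ` R \<inter> R = {}"
    and h: "bij_betw h T (S - R)" and gT: "\<And>x. x \<in> T \<Longrightarrow> g x \<in> T"
    and hg: "\<And>x. x \<in> T \<Longrightarrow> h (g x) = (if f (h x) \<in> R then f (f (h x)) else f (h x))"
  shows "one_orbit S f \<longleftrightarrow> one_orbit T g"
proof
  have inS: "h x \<in> S" "h x \<notin> R" if "x \<in> T" for x
    using h that by (auto simp: bij_betw_def)
  have fS: "f x \<in> S" if "x \<in> S" for x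
    using surj that by blast
  {
    assume f1: "one_orbit S f"
    have reach: "\<exists>j. (g ^^ j) x = y" if "(f ^^ k) (h x) = h y" "x \<in> T" "y \<in> T" for k x y
      using that
    proof (induction k arbitrary: x rule: less_induct)
      case (less k)
      show ?case
      proof (cases k)
        case 0
        then have "x = y" using less.prems h by (auto simp: bij_betw_def inj_on_def)
        then show ?thesis by (intro exI[of _ 0]) simp
      next
        case (Suc k')
        then have k': "(f ^^ k') (f (h x)) = h y"
          using less.prems by (simp add: funpow_swap1)
        have "\<exists>i<k. (f ^^ i) (h (g x)) = h y"
        proof (cases "f (h x) \<in> R")
          case False
          then show ?thesis using k' Suc hg[OF less.prems(2)] by auto
        next
          case True
          then have "k' \<noteq> 0" using k' inS(2)[OF less.prems(3)] by (cases k') auto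
          then obtain i where i: "k' = Suc i" using not0_implies_Suc by blast
          then have "(f ^^ i) (f (f (h x))) = h y" using k' by (simp add: funpow_swap1)
          then show ?thesis using True Suc i hg[OF less.prems(2)] by (intro exI[of _ i]) simp
        qed
        then obtain i where "i < k" "(f ^^ i) (h (g x)) = h y" by blast
        then obtain j where "(g ^^ j) (g x) = y"
          using less.IH less.prems gT by blast
        then show ?thesis by (intro exI[of _ "Suc j"]) (simp add: funpow_swap1)
      qed
    qed
    show "one_orbit T g"
      unfolding one_orbit_def
    proof (intro ballI)
      fix x y assume xy: "x \<in> T" "y \<in> T"
      then obtain k where "(f ^^ k) (h x) = h y" using one_orbitD[OF f1] inS by blast
      then show "\<exists>k. (g ^^ k) x = y" using reach xy by blast
    qed
  }
  assume g1: "one_orbit T g"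
  have step: "\<exists>k. (f ^^ k) (h x) = h (g x)" if "x \<in> T" for x
  proof (cases "f (h x) \<in> R")
    case True
    then show ?thesis using hg[OF that] by (intro exI[of _ 2]) (simp add: numeral_2_eq_2)
  next
    case False
    then show ?thesis using hg[OF that] by (intro exI[of _ 1]) simp
  qed
  have path: "\<exists>k. (f ^^ k) (h x) = h ((g ^^ j) x) \<and> (g ^^ j) x \<in> T" if "x \<in> T" for j x
  proof (induction j)
    case 0
    show ?case using that by (intro exI[of _ 0]) simp
  next
    case (Suc j)
    then obtain k where k: "(f ^^ k) (h x) = h ((g ^^ j) x)" "(g ^^ j) x \<in> T" by blast
    obtain l where "(f ^^ l) (h ((g ^^ j) x)) = h (g ((g ^^ j) x))" using step k by blast
    then have "(f ^^ (l + k)) (h x) = h ((g ^^ Suc j) x)" using k by (simp add: funpow_add)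
    then show ?case using gT k by auto
  qed
  have kept: "\<exists>k. (f ^^ k) x = y" if xyS: "x \<in> S - R" "y \<in> S - R" for x y
  proof -
    have "h ` T = S - R" using h by (simp add: bij_betw_def)
    then obtain x' y' where xy: "x' \<in> T" "x = h x'" "y' \<in> T" "y = h y'"
      using xyS by blast
    then obtain j where "(g ^^ j) x' = y'" using one_orbitD[OF g1] by blast
    then show ?thesis using path[OF xy(1), of j] xy by auto
  qed
  have from_S: "\<exists>k. (f ^^ k) x = y" if xyS: "x \<in> S" "y \<in> S - R" for x y
  proof (cases "x \<in> R")
    case True
    then have "f x \<in> S - R" using R fS xyS by blast
    then obtain k where "(f ^^ k) (f x) = y" using kept xyS by blast
    then show ?thesis by (intro exI[of _ "Suc k"]) (simp add: funpow_swap1)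
  qed (use kept xyS in blast)
  have "\<exists>k. (f ^^ k) x = y" if xyS: "x \<in> S" "y \<in> S" for x y
  proof (cases "y \<in> R")
    case True
    obtain z where z: "z \<in> S" "y = f z" using surj xyS by blast
    then have "z \<in> S - R" using True R by blast
    then obtain k where "(f ^^ k) x = z" using from_S xyS by blast
    then show ?thesis using z by (intro exI[of _ "Suc k"]) simp
  qed (use from_S xyS in blast)
  then show "one_orbit S f" by (auto simp: one_orbit_def)
qed

lemma is_cyclic_iff_one_orbit:
  assumes p: "p permutes {1..n}" and n: "n \<ge> 1"
  shows "is_cyclic n p \<longleftrightarrow> one_orbit {1..n} p"
proof
  assume "is_cyclic n p"
  then obtain cs where cs: "cycle cs" "set cs = {1..n}" "length cs = n" "p = cycle_of_list cs"
    by (auto simp: is_cyclic_def)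
  have reach: "\<exists>k. (p ^^ k) x = y" if xy: "x \<in> set cs" "y \<in> set cs" for x y
  proof -
    obtain i j where ij: "i < n" "x = cs ! i" "j < n" "y = cs ! j"
      using xy[unfolded in_set_conv_nth cs(3)] by blast
    have "(p ^^ (n - i + j)) x = map (p ^^ (n - i + j)) cs ! i"
      using ij cs(3) by simp
    also have "\<dots> = rotate (n - i + j) cs ! i"
      unfolding cs(4) cyclic_rotation[OF cs(1)] ..
    also have "\<dots> = cs ! ((n - i + j + i) mod n)"
      using ij cs(3) by (simp add: nth_rotate)
    also have "(n - i + j + i) mod n = j" using ij by simp
    finally show ?thesis using ij by blast
  qed
  then show "one_orbit {1..n} p" unfolding one_orbit_def cs(2)[symmetric] by blast
next
  assume orb: "one_orbit {1..n} p"
  have perm: "permutation p" using p permutation_permutes by blast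
  let ?cs = "support p 1"
  have cs: "cycle ?cs" using cycle_of_permutation[OF perm] .
  have "(p ^^ i) 1 \<in> {1..n}" for i
    using permutes_in_image[OF permutes_funpow[OF p], of i 1] n by simp
  moreover have "y \<in> range (\<lambda>i. (p ^^ i) 1)" if "y \<in> {1..n}" for y
    using one_orbitD[OF orb _ that, of 1] n by (auto intro: range_eqI[OF sym])
  ultimately have set: "set ?cs = {1..n}"
    unfolding support_set[OF perm] by blast
  have len: "length ?cs = n"
    using distinct_card[OF cs] unfolding set by simp
  have "p = cycle_of_list ?cs"
  proof
    fix x
    show "p x = cycle_of_list ?cs x"
    proof (cases "x \<in> set ?cs")
      case True
      then show ?thesis by (rule cycle_restrict[OF perm])
    next
      case False
      then have "p x = x" unfolding set using permutes_not_in[OF p] by blast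
      then show ?thesis using id_outside_supp[OF False] by simp
    qed
  qed
  then show "is_cyclic n p" unfolding is_cyclic_def using cs set len by (intro exI[of _ ?cs] conjI)
qed

section \<open>The block exchange of a composition\<close>

text \<open>
  The iterated skew sum of identities as a permutation of \<open>{..<sum_list as}\<close>, that is with
  positions and values counted from \<open>0\<close>.  A part \<open>0\<close> contributes nothing, which lets the case
  \<open>a\<^sub>1 = 2 * a\<^sub>k\<close> of the reduction be treated as the case \<open>a\<^sub>1 > 2 * a\<^sub>k\<close> with an empty first block.
\<close>
fun block_map :: "nat list \<Rightarrow> nat \<Rightarrow> nat" where
  "block_map [] x = x"
| "block_map (a # as) x = (if x < a then x + sum_list as else block_map as (x - a))"

lemma length_id_list: "length (id_list a) = a"
  by (simp add: id_list_def)

lemma length_skew_sum: "length (skew_sum s t) = length s + length t"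
  by (simp add: skew_sum_def)

lemma nth_skew_sum:
  "skew_sum s t ! i = (if i < length s then s ! i + length t else t ! (i - length s))"
  by (simp add: skew_sum_def nth_append)

lemma length_skew: "length (foldr skew_sum (map id_list as) []) = sum_list as"
  by (induction as) (simp_all add: length_skew_sum length_id_list)

lemma nth_skew:
  "x < sum_list as \<Longrightarrow> foldr skew_sum (map id_list as) [] ! x = Suc (block_map as x)"
proof (induction as arbitrary: x)
  case (Cons a as)
  show ?case
  proof (cases "x < a")
    case True
    then have "id_list a ! x = Suc x" by (simp add: id_list_def del: upt_Suc)
    then show ?thesis using True by (simp add: nth_skew_sum length_skew length_id_list)
  next
    case False
    then show ?thesis using Cons.IH[of "x - a"] Cons.prems
      by (simp add: nth_skew_sum length_id_list)
  qed
qed simp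

lemma block_map_less: "x < sum_list as \<Longrightarrow> block_map as x < sum_list as"
proof (induction as arbitrary: x)
  case (Cons a as)
  have "x - a < sum_list as" if "\<not> x < a" using that Cons.prems by auto
  then show ?case using Cons.IH[of "x - a"] by fastforce
qed simp

lemma block_map_snoc:
  "x < sum_list as + a \<Longrightarrow>
    block_map (as @ [a]) x = (if x < sum_list as then a + block_map as x else x - sum_list as)"
proof (induction as arbitrary: x)
  case (Cons b as)
  have "x - b < sum_list as + a" if "\<not> x < b" using that Cons.prems by auto
  then show ?case using Cons.IH[of "x - b"] by (cases "x < b") auto
qed simp

text \<open>The blocks of the inverse are the images of the blocks, which occur in the opposite order.\<close>
lemma block_map_rev: "x < sum_list as \<Longrightarrow> block_map (rev as) (block_map as x) = x"
proof (induction as arbitrary: x)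
  case (Cons a as)
  show ?case
  proof (cases "x < a")
    case True
    then show ?thesis by (simp add: block_map_snoc sum_list_rev)
  next
    case False
    then have "x - a < sum_list as" using Cons.prems by auto
    then show ?thesis
      using False Cons.IH[of "x - a"] block_map_less[of "x - a" as]
      by (simp add: block_map_snoc sum_list_rev)
  qed
qed simp

lemma block_map_surj: "y < sum_list as \<Longrightarrow> \<exists>x<sum_list as. block_map as x = y"
  using block_map_rev[of y "rev as"] block_map_less[of y "rev as"]
  by (intro exI[of _ "block_map (rev as) y"]) (simp add: sum_list_rev)

lemma block_map_image: "block_map as ` {..<sum_list as} = {..<sum_list as}"
proof (intro equalityI subsetI)
  fix y assume "y \<in> {..<sum_list as}"
  then show "y \<in> block_map as ` {..<sum_list as}" using block_map_surj[of y as] by auto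
qed (use block_map_less in auto)

definition block_cyclic :: "nat list \<Rightarrow> bool" where
  "block_cyclic as \<longleftrightarrow> one_orbit {..<sum_list as} (block_map as)"

lemma block_cyclic_rev: "block_cyclic (rev as) \<longleftrightarrow> block_cyclic as"
proof -
  have "block_cyclic bs \<Longrightarrow> block_cyclic (rev bs)" for bs
    unfolding block_cyclic_def sum_list_rev
    by (rule one_orbit_left_inverse[of _ "block_map bs"]) (simp_all add: block_map_less block_map_rev)
  from this[of as] this[of "rev as"] show ?thesis by auto
qed

lemma one_line_skew:
  assumes "one_line n p = foldr skew_sum (map id_list as) []" "x < n" "sum_list as = n"
  shows "p (Suc x) = Suc (block_map as x)"
proof -
  have "one_line n p ! x = p (Suc x)"
    using assms(2) by (simp add: one_line_def del: upt_Suc)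
  then show ?thesis using assms nth_skew by simp
qed

lemma is_cyclic_iff_block_cyclic:
  assumes p: "p permutes {1..n}" and n: "n \<ge> 1" and sum: "sum_list as = n"
    and line: "one_line n p = foldr skew_sum (map id_list as) []"
  shows "is_cyclic n p \<longleftrightarrow> block_cyclic as"
proof -
  have "one_orbit {1..n} p \<longleftrightarrow> one_orbit {..<n} (block_map as)"
  proof (rule one_orbit_first_return[where R = "{}" and h = Suc])
    show "p ` {1..n} = {1..n}" using permutes_image[OF p] .
    show "bij_betw Suc {..<n} ({1..n} - {})"
      by (rule bij_betw_byWitness[where f' = "\<lambda>x. x - 1"]) auto
    fix x assume x: "x \<in> {..<n}"
    then show "block_map as x \<in> {..<n}" using block_map_less[of x as] sum by simp
    show "Suc (block_map as x) = (if p (Suc x) \<in> {} then p (p (Suc x)) else p (Suc x))"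
      using one_line_skew[OF line _ sum, of x] x by simp
  qed simp_all
  then show ?thesis
    using is_cyclic_iff_one_orbit[OF p n] sum by (simp add: block_cyclic_def)
qed

section \<open>Cutting out blocks\<close>

text \<open>
  The interval exchange sending the order \<open>c\<close>, \<open>b\<close>, \<open>M\<close> to \<open>b\<close>, reversed \<open>M\<close>, \<open>c\<close>.  A block map
  would reverse the order of \<open>b\<close> and \<open>M\<close> as well.
\<close>
definition shear :: "nat \<Rightarrow> nat \<Rightarrow> nat list \<Rightarrow> nat \<Rightarrow> nat" where
  "shear c b M x =
    (if x < c then x + b + sum_list M
     else if x < c + b then x - c
     else b + block_map M (x - (c + b)))"

lemma shear_less:
  "x < c + b + sum_list M \<Longrightarrow> shear c b M x < c + b + sum_list M"
  using block_map_less[of "x - (c + b)" M]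
  by (cases "x - (c + b) < sum_list M") (auto simp: shear_def)

lemma shear_image: "shear c b M ` {..<c + b + sum_list M} = {..<c + b + sum_list M}"
proof (intro equalityI subsetI)
  fix y assume y: "y \<in> {..<c + b + sum_list M}"
  consider "y < b" | "b \<le> y" "y < b + sum_list M" | "b + sum_list M \<le> y" by linarith
  then show "y \<in> shear c b M ` {..<c + b + sum_list M}"
  proof cases
    case 1
    then show ?thesis by (intro image_eqI[of _ _ "y + c"]) (auto simp: shear_def)
  next
    case 2
    then have "y - b < sum_list M" by linarith
    then obtain x where "x < sum_list M" "block_map M x = y - b"
      using block_map_surj by blast
    then show ?thesis using 2
      by (intro image_eqI[of _ _ "x + (c + b)"]) (auto simp: shear_def)
  next
    case 3
    then show ?thesis using y
      by (intro image_eqI[of _ _ "y - (b + sum_list M)"]) (auto simp: shear_def)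
  qed
qed (use shear_less in auto)

text \<open>
  The last \<open>b\<close> points are the image of the end of the first block and are mapped onto the first
  \<open>b\<close> points; cutting them out splits the first block into pieces \<open>c\<close> and \<open>b\<close>.
\<close>
lemma one_orbit_cut_last_block:
  "block_cyclic ((c + b) # M @ [b]) \<longleftrightarrow> one_orbit {..<c + b + sum_list M} (shear c b M)"
proof -
  let ?n = "c + b + sum_list M + b"
  let ?R = "{c + b + sum_list M..<?n}"
  let ?f = "block_map ((c + b) # M @ [b])"
  have f: "?f x = (if x < c + b then x + sum_list M + b
      else if x < c + b + sum_list M then b + block_map M (x - (c + b))
      else x - (c + b + sum_list M))" if "x < ?n" for x
    using that block_map_snoc[of "x - (c + b)" M b] by auto
  have "one_orbit {..<?n} ?f \<longleftrightarrow> one_orbit {..<c + b + sum_list M} (shear c b M)"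
  proof (rule one_orbit_first_return[where R = ?R and h = id])
    show "?f ` {..<?n} = {..<?n}"
      using block_map_image[of "(c + b) # M @ [b]"] by (simp add: add.assoc)
    show "?f ` ?R \<inter> ?R = {}" using f by (auto simp del: block_map.simps)
    show "bij_betw id {..<c + b + sum_list M} ({..<?n} - ?R)"
      by (rule bij_betw_byWitness[where f' = id]) auto
    fix x assume x: "x \<in> {..<c + b + sum_list M}"
    then show "shear c b M x \<in> {..<c + b + sum_list M}" using shear_less by simp
    have "?f x < ?n"
      using block_map_less[of x "(c + b) # M @ [b]"] x by (simp add: add.assoc)
    note f2 = f[OF this]
    have small: "c + b \<le> x \<Longrightarrow> block_map M (x - (c + b)) < sum_list M"
      using x block_map_less[of "x - (c + b)" M] by auto
    show "id (shear c b M x) = (if ?f (id x) \<in> ?R then ?f (?f (id x)) else ?f (id x))"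
      unfolding id_apply f2 using x small
      by (subst (1 2 3 4 5) f) (auto simp: shear_def)
  qed auto
  then show ?thesis by (simp add: block_cyclic_def add.assoc)
qed

text \<open>
  The first \<open>c\<close> points are the image of the beginning of the interval \<open>c + d\<close> and are mapped onto
  the last \<open>c\<close> points.
\<close>
lemma one_orbit_shear_diff:
  "one_orbit {..<c + (c + d) + sum_list M} (shear c (c + d) M)
    \<longleftrightarrow> one_orbit {..<c + d + sum_list M} (shear c d M)"
proof (rule one_orbit_first_return[where R = "{..<c}" and h = "\<lambda>x. x + c"])
  show "bij_betw (\<lambda>x. x + c) {..<c + d + sum_list M} ({..<c + (c + d) + sum_list M} - {..<c})"
    by (rule bij_betw_byWitness[where f' = "\<lambda>x. x - c"]) auto
qed (auto simp: shear_image shear_less, auto simp: shear_def split: if_splits)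

text \<open>
  The first \<open>b\<close> points are the image of the interval \<open>b\<close>.  Once they are cut out, \<open>b\<close> is mapped
  to the place just before the image of the remaining \<open>d\<close> points, so that the order of all the
  intervals is reversed.
\<close>
lemma one_orbit_cut_shear:
  "one_orbit {..<b + d + b + sum_list M} (shear (b + d) b M) \<longleftrightarrow> block_cyclic (d # b # M)"
  unfolding block_cyclic_def
proof (rule one_orbit_first_return[where R = "{..<b}" and h = "\<lambda>x. x + b"])
  show "bij_betw (\<lambda>x. x + b) {..<sum_list (d # b # M)} ({..<b + d + b + sum_list M} - {..<b})"
    by (rule bij_betw_byWitness[where f' = "\<lambda>x. x - b"]) auto
  show "shear (b + d) b M ` {..<b + d + b + sum_list M} = {..<b + d + b + sum_list M}"
    by (rule shear_image)
  fix x assume "x \<in> {..<sum_list (d # b # M)}"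
  then show "block_map (d # b # M) x \<in> {..<sum_list (d # b # M)}"
    using block_map_less by blast
qed (auto simp: shear_def add.commute[of d b])

section \<open>The reduction procedure\<close>

text \<open>
  With \<open>c = a - b\<close>, the branches of the reduction are \<open>c < b\<close>, \<open>c > b\<close> and \<open>c = b\<close>; the last two are
  one case, because the block map ignores the leading part \<open>c - b = 0\<close>.
\<close>
lemma block_cyclic_reduction:
  assumes "a > b"
  shows "block_cyclic (reduction (a # M @ [b])) \<longleftrightarrow> block_cyclic (a # M @ [b])"
proof -
  define c where "c = a - b"
  have a: "a = c + b" using assms by (simp add: c_def)
  have cut: "block_cyclic (a # M @ [b]) \<longleftrightarrow> one_orbit {..<c + b + sum_list M} (shear c b M)"
    unfolding a by (rule one_orbit_cut_last_block)
  show ?thesis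
  proof (cases "c < b")
    case True
    define d where "d = b - c"
    have b: "b = c + d" using True by (simp add: d_def)
    have "block_cyclic (a # M @ [b]) \<longleftrightarrow> block_cyclic ((c + d) # M @ [d])"
      unfolding one_orbit_cut_last_block cut unfolding b by (rule one_orbit_shear_diff)
    moreover have "reduction (a # M @ [b]) = (c + d) # M @ [d]"
      using True assms by (simp add: reduction_def a b)
    ultimately show ?thesis by simp
  next
    case False
    define d where "d = c - b"
    have c: "c = b + d" using False by (simp add: d_def)
    have "block_cyclic (a # M @ [b]) \<longleftrightarrow> block_cyclic (d # b # M)"
      unfolding cut c by (rule one_orbit_cut_shear)
    moreover have "block_map (0 # b # M) = block_map (b # M)"
      by (rule ext) simp
    then have "block_cyclic (d # b # M) \<longleftrightarrow> block_cyclic (reduction (a # M @ [b]))"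
      by (cases "d = 0") (simp_all add: reduction_def a c block_cyclic_def del: block_map.simps)
    ultimately show ?thesis by simp
  qed
qed

lemma not_stoppedE:
  assumes "\<not> stopped as" "as \<noteq> []"
  obtains a M b where "as = a # M @ [b]" "a \<noteq> b"
proof -
  obtain a t where t: "as = a # t" using assms(2) by (cases as) auto
  moreover have "t \<noteq> []" using assms(1) t by (auto simp: stopped_def)
  ultimately obtain M b where "as = a # M @ [b]" by (metis rev_exhaust)
  with assms(1) that show thesis by (auto simp: stopped_def)
qed

text \<open>The extra \<open>1\<close> pays for a reversal, which keeps the sum but leaves the larger part in front.\<close>
definition step_measure :: "nat list \<Rightarrow> nat" where
  "step_measure as = 2 * sum_list as + (if hd as < last as then 1 else 0)"

lemma step_preserves:
  assumes pos: "\<forall>x\<in>set as. 0 < x" and ne: "as \<noteq> []" and ns: "\<not> stopped as"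
  shows "\<forall>x\<in>set (step as). 0 < x" "step as \<noteq> []"
    "block_cyclic (step as) \<longleftrightarrow> block_cyclic as" "step_measure (step as) < step_measure as"
proof -
  obtain a M b where as: "as = a # M @ [b]" "a \<noteq> b" using not_stoppedE[OF ns ne] .
  have ab: "0 < a" "0 < b" using pos as by auto
  have "(\<forall>x\<in>set (step as). 0 < x) \<and> step as \<noteq> [] \<and>
    (block_cyclic (step as) \<longleftrightarrow> block_cyclic as) \<and> step_measure (step as) < step_measure as"
  proof (cases "a < b")
    case True
    then have "step as = rev as" using as by (simp add: step_def)
    moreover have "step_measure (rev as) < step_measure as"
      using True as by (simp add: step_measure_def sum_list_rev)
    ultimately show ?thesis using pos ne block_cyclic_rev by simp
  next
    case False
    then have st: "step as = reduction as" using as by (simp add: step_def)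
    have "sum_list (reduction as) < sum_list as" "\<forall>x\<in>set (reduction as). 0 < x" "reduction as \<noteq> []"
      using False as ab pos by (auto simp: reduction_def Let_def)
    then show ?thesis
      using st block_cyclic_reduction[of b a M] False as by (auto simp: step_measure_def)
  qed
  then show "\<forall>x\<in>set (step as). 0 < x" "step as \<noteq> []"
    "block_cyclic (step as) \<longleftrightarrow> block_cyclic as" "step_measure (step as) < step_measure as"
    by auto
qed

text \<open>
  A single part gives an identity, which fixes \<open>0\<close>; if the outer parts are equal, the first points
  of the outer blocks are interchanged.  So a single orbit has at most one or two points.
\<close>
lemma block_cyclic_stopped:
  assumes pos: "\<forall>x\<in>set as. 0 < x" and ne: "as \<noteq> []" and st: "stopped as"
  shows "block_cyclic as \<longleftrightarrow> as = [1, 1] \<or> as = [1]"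
proof
  assume cyc: "block_cyclic as"
  obtain a t where t: "as = a # t" using ne by (cases as) auto
  have a: "0 < a" using pos t by simp
  show "as = [1, 1] \<or> as = [1]"
  proof (cases "t = []")
    case True
    have "{..<a} \<subseteq> {0}"
      by (rule one_orbit_subset_invariant[of _ "block_map as" 0])
        (use cyc a t True in \<open>auto simp: block_cyclic_def\<close>)
    then have "a = 1" using a by (metis Suc_lessI lessThan_iff One_nat_def singletonD subsetD zero_neq_one)
    then show ?thesis using t True by simp
  next
    case False
    then obtain M b where "t = M @ [b]" by (metis rev_exhaust)
    then have M: "as = a # M @ [a]" using t st by (auto simp: stopped_def)
    let ?T = "{0, a + sum_list M}"
    have "{..<sum_list as} \<subseteq> ?T"
    proof (rule one_orbit_subset_invariant[of _ "block_map as" 0])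
      show "block_map as ` ?T \<subseteq> ?T" using M a by (auto simp: block_map_snoc)
    qed (use cyc a M in \<open>auto simp: block_cyclic_def\<close>)
    then have "card {..<sum_list as} \<le> card ?T" by (intro card_mono) auto
    also have "\<dots> \<le> 2" by (simp add: card_insert_if)
    finally have "2 * a + sum_list M \<le> 2" using M by simp
    then have "a = 1" "sum_list M = 0" using a by linarith+
    moreover have "M = []"
      using calculation(2) pos M by (cases M) auto
    ultimately show ?thesis using M by simp
  qed
next
  have "\<exists>k. (block_map [1, 1] ^^ k) x = y" if "x < 2" "y < 2" for x y
    using that by (intro exI[of _ "if x = y then 0 else 1"]) auto
  then have "block_cyclic [1, 1]"
    by (auto simp: block_cyclic_def one_orbit_def numeral_2_eq_2)
  moreover have "block_cyclic [1]"
    by (auto simp: block_cyclic_def one_orbit_def intro: exI[of _ 0])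
  moreover assume "as = [1, 1] \<or> as = [1]"
  ultimately show "block_cyclic as" by auto
qed

lemma procedure_decides_block_cyclic:
  assumes "\<forall>x\<in>set as. 0 < x" "as \<noteq> []"
  shows "\<exists>c. procedure as = Some c \<and> (block_cyclic as \<longleftrightarrow> c = [1, 1] \<or> c = [1])"
proof -
  let ?P = "\<lambda>bs. (\<forall>x\<in>set bs. 0 < x) \<and> bs \<noteq> [] \<and> (block_cyclic bs \<longleftrightarrow> block_cyclic as)"
  have step: "?P (step bs) \<and> step_measure (step bs) < step_measure bs"
    if "?P bs" "\<not> stopped bs" for bs
    using that step_preserves[of bs] by simp
  obtain c where c: "procedure as = Some c"
    using measure_while_option_Some[of ?P "\<lambda>b. \<not> stopped b" step step_measure as] step assms
    unfolding procedure_def by auto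
  have "?P c"
    by (rule while_option_rule[OF _ c[unfolded procedure_def]]) (use step assms in auto)
  moreover have "stopped c"
    using while_option_stop[OF c[unfolded procedure_def]] by simp
  ultimately have "block_cyclic as \<longleftrightarrow> c = [1, 1] \<or> c = [1]"
    using block_cyclic_stopped by metis
  then show ?thesis using c by blast
qed

section \<open>Permutations avoiding 132 and 213\<close>

lemma contains_132:
  assumes "subseq [a, b, c] w" "a < c" "c < b"
  shows "contains_pattern w [1, 3, 2]"
  unfolding contains_pattern_def order_iso_def
  using assms by (intro exI[of _ "[a, b, c]"]) (auto simp: less_Suc_eq)

lemma contains_213:
  assumes "subseq [a, b, c] w" "b < a" "a < c"
  shows "contains_pattern w [2, 1, 3]"
  unfolding contains_pattern_def order_iso_def
  using assms by (intro exI[of _ "[a, b, c]"]) (auto simp: less_Suc_eq)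

lemma contains_pattern_mono: "subseq v w \<Longrightarrow> contains_pattern v s \<Longrightarrow> contains_pattern w s"
  unfolding contains_pattern_def by (meson subseq_order.order_trans)

lemma subseq_pair_if_not_sorted:
  "\<not> sorted (xs :: nat list) \<Longrightarrow> \<exists>b c. subseq [b, c] xs \<and> c < b"
proof (induction xs)
  case (Cons x xs)
  show ?case
  proof (cases "sorted xs")
    case True
    then obtain c where c: "c \<in> set xs" "c < x" using Cons.prems by auto
    then have "subseq [x, c] (x # xs)" by (simp add: subseq_singleton_left)
    then show ?thesis using c by blast
  next
    case False
    then show ?thesis using Cons.IH by (metis list_emb_Cons)
  qed
qed simp

text \<open>
  If \<open>v\<close> is the first letter, then avoiding 213 puts all larger letters before all smaller ones,
  and avoiding 132 puts the larger ones in increasing order.  Hence the word starts with the run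
  \<open>v, v + 1, \<dots>, n\<close>, which is a leading identity block, and the rest is a shorter avoiding word.
\<close>
lemma avoiding_word_is_skew_sum:
  assumes "distinct w" "set w = {1..n}"
    "\<not> contains_pattern w [1, 3, 2]" "\<not> contains_pattern w [2, 1, 3]"
  shows "\<exists>as. composition n as \<and> w = foldr skew_sum (map id_list as) []"
  using assms
proof (induction n arbitrary: w rule: less_induct)
  case (less n)
  show ?case
  proof (cases w)
    case Nil
    then have "n = 0" using less.prems by auto
    then show ?thesis using Nil by (intro exI[of _ "[]"]) (simp add: composition_def)
  next
    case (Cons v t)
    have v: "1 \<le> v" "v \<le> n" using less.prems(2) Cons by auto
    define u where "u = takeWhile (\<lambda>x. v \<le> x) t"
    define r where "r = dropWhile (\<lambda>x. v \<le> x) t"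
    have w: "w = v # u @ r" using Cons by (simp add: u_def r_def)
    have u: "\<forall>x\<in>set u. v \<le> x" by (auto simp: u_def dest: set_takeWhileD)
    have r: "\<forall>x\<in>set r. x < v"
    proof (cases r)
      case (Cons y ys)
      have y: "y < v" using Cons hd_dropWhile[of "\<lambda>x. v \<le> x" t] by (simp add: r_def)
      have "x < v" if "x \<in> set ys" for x
      proof (rule ccontr)
        assume "\<not> x < v"
        moreover have "x \<noteq> v" using less.prems(1) w Cons that by auto
        ultimately have "v < x" by simp
        moreover have "subseq [v, y, x] w"
          using that by (auto simp: w Cons subseq_singleton_left intro: list_emb_append2)
        ultimately show False using contains_213[of v y x w] y less.prems(4) by simp
      qed
      then show ?thesis using y Cons by auto
    qed simp
    have sorted: "sorted (v # u)"
    proof (rule ccontr)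
      assume "\<not> sorted (v # u)"
      then have "\<not> sorted u" using u by simp
      then obtain b c where bc: "subseq [b, c] u" "c < b" using subseq_pair_if_not_sorted by blast
      have "c \<in> set u" using list_emb_set[OF bc(1), of c] by auto
      then have "v < c" using u less.prems(1) w by (cases "c = v") auto
      moreover have "subseq [v, b, c] w" using bc(1) by (auto simp: w)
      ultimately show False using contains_132[of v b c w] bc(2) less.prems(3) by simp
    qed
    have set_r: "set r = {1..v - 1}" and set_u: "set (v # u) = {v..n}"
    proof -
      have mem: "x \<in> set (v # u) \<or> x \<in> set r \<longleftrightarrow> 1 \<le> x \<and> x \<le> n" for x
        using less.prems(2) unfolding w by (auto simp: set_eq_iff)
      have vu: "v \<le> x" if "x \<in> set (v # u)" for x using u that by auto
      have "x \<in> set r \<longleftrightarrow> 1 \<le> x \<and> x < v" for x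
        using mem[of x] vu[of x] r v by (meson leD le_trans less_imp_le_nat)
      moreover have "1 \<le> x \<and> x < v \<longleftrightarrow> x \<in> {1..v - 1}" for x using v by auto
      ultimately show "set r = {1..v - 1}" by (intro set_eqI) (simp only:)
      have "x \<in> set (v # u) \<longleftrightarrow> v \<le> x \<and> x \<le> n" for x
        using mem[of x] vu[of x] r v by (meson leD le_trans)
      then show "set (v # u) = {v..n}" by (intro set_eqI) (simp only: atLeastAtMost_iff)
    qed
    have run: "v # u = [v..<Suc n]"
      using sorted less.prems(1) w set_u
      by (intro sorted_distinct_set_unique) (auto simp del: upt_Suc)
    have dr: "distinct r" using less.prems(1) unfolding w by simp
    have sub: "subseq r w" by (auto simp: w intro: list_emb_append2)
    have "v - 1 < n" using v by simp
    moreover have "\<not> contains_pattern r [1, 3, 2]" "\<not> contains_pattern r [2, 1, 3]"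
      using contains_pattern_mono[OF sub] less.prems(3,4) by blast+
    ultimately obtain as
      where as: "composition (v - 1) as" "r = foldr skew_sum (map id_list as) []"
      using less.IH[OF _ dr set_r] by blast
    have len: "length r = v - 1" using distinct_card[OF dr] set_r by simp
    have "map (\<lambda>x. x + (v - 1)) (id_list (Suc n - v)) = [v..<Suc n]"
      using v by (intro nth_equalityI) (auto simp: id_list_def simp del: upt_Suc)
    then have "w = skew_sum (id_list (Suc n - v)) r"
      using run w len by (simp add: skew_sum_def)
    moreover have "composition n ((Suc n - v) # as)"
      using as(1) v by (auto simp: composition_def)
    ultimately show ?thesis using as(2) by (intro exI[of _ "(Suc n - v) # as"]) simp
  qed
qed

lemma skew_sum_cancel: "skew_sum s t = skew_sum s t' \<Longrightarrow> length t = length t' \<Longrightarrow> t = t'"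
  by (simp add: skew_sum_def)

text \<open>The first letter determines the sum of all parts but the first.\<close>
lemma skew_sum_decomposition_unique:
  assumes "composition n as" "composition n bs"
    "foldr skew_sum (map id_list as) [] = foldr skew_sum (map id_list bs) []"
  shows "as = bs"
  using assms
proof (induction as arbitrary: n bs)
  case Nil
  then show ?case by (cases bs) (auto simp: composition_def)
next
  case (Cons a as)
  then obtain b bs' where bs: "bs = b # bs'"
    by (cases bs) (auto simp: composition_def)
  have pos: "0 < a" "0 < b" and sums: "a + sum_list as = n" "b + sum_list bs' = n"
    using Cons.prems bs by (auto simp: composition_def)
  have skew: "skew_sum (id_list a) (foldr skew_sum (map id_list as) []) =
      skew_sum (id_list b) (foldr skew_sum (map id_list bs') [])"
    using Cons.prems(3) unfolding bs by simp
  have "Suc (block_map (a # as) 0) = Suc (block_map (b # bs') 0)"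
    using nth_skew[of 0 "a # as"] nth_skew[of 0 "b # bs'"] pos by (simp add: skew)
  then have sum: "sum_list as = sum_list bs'" using pos by simp
  then have ab: "a = b" using sums by simp
  have "foldr skew_sum (map id_list as) [] = foldr skew_sum (map id_list bs') []"
    by (rule skew_sum_cancel[OF skew[folded ab]]) (simp add: length_skew sum)
  moreover have "composition (sum_list as) as" "composition (sum_list as) bs'"
    using Cons.prems(1,2) unfolding bs by (simp_all add: composition_def sum)
  ultimately have "as = bs'" using Cons.IH by blast
  then show ?case unfolding bs ab by simp
qed

lemma kappa_avoider:
  assumes "p \<in> avoiders n {[1, 3, 2], [2, 1, 3]}"
  shows "composition n (kappa n p)"
    "one_line n p = foldr skew_sum (map id_list (kappa n p)) []"
proof -
  have p: "p permutes {1..n}" using assms by (simp add: avoiders_def)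
  have "distinct (one_line n p)"
    using permutes_inj_on[OF p] by (simp add: one_line_def distinct_map del: upt_Suc)
  moreover have "set (one_line n p) = {1..n}"
    using permutes_image[OF p] by (simp add: one_line_def atLeastLessThanSuc_atLeastAtMost del: upt_Suc)
  ultimately obtain as where
    as: "composition n as" "one_line n p = foldr skew_sum (map id_list as) []"
    using avoiding_word_is_skew_sum[of "one_line n p" n] assms by (auto simp: avoiders_def)
  have "kappa n p = as"
    unfolding kappa_def
  proof (rule the_equality)
    fix bs assume "composition n bs \<and> one_line n p = foldr skew_sum (map id_list bs) []"
    then show "bs = as" using as skew_sum_decomposition_unique[of n bs as] by simp
  qed (use as in blast)
  then show "composition n (kappa n p)"
    "one_line n p = foldr skew_sum (map id_list (kappa n p)) []" using as by auto
qed

theorem mainTheorem2: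
  fixes n :: nat and p :: "nat \<Rightarrow> nat"
  assumes "n \<ge> 1"
    and "p \<in> avoiders n {[1, 3, 2], [2, 1, 3]}"
  shows "\<exists>c. procedure (kappa n p) = Some c \<and>
           (c = [1, 1] \<or> c = [1] \<longrightarrow> is_cyclic n p) \<and>
           (\<not> (c = [1, 1] \<or> c = [1]) \<longrightarrow> \<not> is_cyclic n p)"
proof -
  have pos: "\<forall>x\<in>set (kappa n p). 0 < x" and sum: "sum_list (kappa n p) = n"
    using kappa_avoider(1)[OF assms(2)] by (auto simp: composition_def)
  have "kappa n p \<noteq> []" using sum assms(1) by auto
  then obtain c where c: "procedure (kappa n p) = Some c"
    "block_cyclic (kappa n p) \<longleftrightarrow> c = [1, 1] \<or> c = [1]"
    using procedure_decides_block_cyclic pos by blast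
  have "p permutes {1..n}" using assms(2) by (simp add: avoiders_def)
  then have "is_cyclic n p \<longleftrightarrow> block_cyclic (kappa n p)"
    using is_cyclic_iff_block_cyclic assms(1) sum kappa_avoider(2)[OF assms(2)] by blast
  then show ?thesis using c by blast
qed

end
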